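(* Let $a,b$ be positive integers, $P=[a]\times[b]$, $\mathbb{K}$ a field of characteristic zero, $C\in\mathbb{K}$ a generic constant, and $g\in\mathbb{K}^P$ a (generic) labeling. Then (1) $(\operatorname{BAR} g)(1,1)=\dfrac{C}{(\Delta^{-1}g)(1,1)}$; (2) $(\operatorname{BAR} g)(1,j)=\dfrac{(\Delta^{-1}g)(1,j-1)}{(\Delta^{-1}g)(1,j)}$ for $j\ge2$; (3) $(\operatorname{BAR} g)(i,1)=\dfrac{(\Delta^{-1}g)(i-1,1)}{(\Delta^{-1}g)(i,1)}$ for $i\ge2$; (4) $(\operatorname{BAR} g)(i,j)=\dfrac{(\Delta^{-1}g)(i-1,j)\cdot(\Delta^{-1}g)(i,j-1)\cdot g(i-1,j-1)}{(\Delta^{-1}g)(i-1,j-1)\cdot(\Delta^{-1}g)(i,j)}$ for $i,j\ge2$.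
   Context: $[n]=\{1,\dots,n\}$; $P=[a]\times[b]$ has componentwise order, and $(i,j)$ is covered exactly by $(i+1,j)$ and $(i,j+1)$ when these lie in $P$. All maps are birational maps on $\mathbb{K}^P$ (labelings $P\to\mathbb{K}$), defined for generic labelings. Define: $(\Theta f)(x)=C/f(x)$; $(\nabla f)(x)=f(x)/\sum_{y\lessdot x}f(y)$, where the empty sum (for $x$ minimal) is replaced by $1$; $(\Delta^{-1}f)(x)=\sum f(y_1)f(y_2)\cdots f(y_k)$ over all saturated chains $x=y_1\lessdot y_2\lessdot\cdots\lessdot y_k$ with $y_k$ maximal in $P$, equivalently $(\Delta^{-1}f)(x)=f(x)\sum_{y\gtrdot x}(\Delta^{-1}f)(y)$ with the empty sum equal to $1$. Birational antichain rowmotion is $\operatorname{BAR}=\nabla\circ\Theta\circ\Delta^{-1}$. *)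

theory Defs
  imports "HOL-Library.Product_Order" Complex_Main
begin

text \<open>
  A poset is a set \<open>P\<close> with the order of its ambient type. For pairs of natural numbers this is
  the componentwise order, provided by \<open>Product_Order\<close>. A labeling of \<open>P\<close> is a total function;
  its values outside \<open>P\<close> play no role.
\<close>

definition covered_by :: "'p::order set \<Rightarrow> 'p \<Rightarrow> 'p \<Rightarrow> bool" where
  "covered_by P x y \<longleftrightarrow> x \<in> P \<and> y \<in> P \<and> x < y \<and> \<not> (\<exists>z\<in>P. x < z \<and> z < y)"

definition saturated_chains :: "'p::order set \<Rightarrow> 'p \<Rightarrow> 'p list set" where
  "saturated_chains P x = {ys. ys \<noteq> [] \<and> set ys \<subseteq> P \<and> hd ys = x \<and>
     successively (covered_by P) ys \<and> \<not> (\<exists>z\<in>P. last ys < z)}"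

definition Delta_inv :: "'p::order set \<Rightarrow> ('p \<Rightarrow> 'k::field) \<Rightarrow> 'p \<Rightarrow> 'k" where
  "Delta_inv P f x = (\<Sum>ys\<in>saturated_chains P x. prod_list (map f ys))"

definition Theta :: "'k::field \<Rightarrow> ('p \<Rightarrow> 'k) \<Rightarrow> 'p \<Rightarrow> 'k" where
  "Theta C f x = C / f x"

definition lower_sum :: "'p::order set \<Rightarrow> ('p \<Rightarrow> 'k::field) \<Rightarrow> 'p \<Rightarrow> 'k" where
  "lower_sum P f x = (if {y. covered_by P y x} = {} then 1 else \<Sum>y | covered_by P y x. f y)"

definition Nabla :: "'p::order set \<Rightarrow> ('p \<Rightarrow> 'k::field) \<Rightarrow> 'p \<Rightarrow> 'k" where
  "Nabla P f x = f x / lower_sum P f x"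

definition BAR :: "'p::order set \<Rightarrow> 'k::field \<Rightarrow> ('p \<Rightarrow> 'k) \<Rightarrow> ('p \<Rightarrow> 'k)" where
  "BAR P C = Nabla P \<circ> Theta C \<circ> Delta_inv P"

text \<open>
  Division by zero yields zero in HOL, so the rational maps above become total functions. The
  labelings at which they are really defined are recorded separately: those at which no
  denominator vanishes. \<open>Delta_inv\<close> is polynomial, hence defined everywhere.
\<close>

definition Theta_dom :: "'p set \<Rightarrow> ('p \<Rightarrow> 'k::field) set" where
  "Theta_dom P = {f. \<forall>x\<in>P. f x \<noteq> 0}"

definition Nabla_dom :: "'p::order set \<Rightarrow> ('p \<Rightarrow> 'k::field) set" where
  "Nabla_dom P = {f. \<forall>x\<in>P. lower_sum P f x \<noteq> 0}"

definition BAR_dom :: "'p::order set \<Rightarrow> 'k::field \<Rightarrow> ('p \<Rightarrow> 'k) set" where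
  "BAR_dom P C = {g. Delta_inv P g \<in> Theta_dom P \<and> Theta C (Delta_inv P g) \<in> Nabla_dom P}"

definition rect :: "nat \<Rightarrow> nat \<Rightarrow> (nat \<times> nat) set" where
  "rect a b = {1..a} \<times> {1..b}"

lemma covered_by_rect:
  "covered_by (rect a b) (i, j) y \<longleftrightarrow>
     (i, j) \<in> rect a b \<and> y \<in> rect a b \<and> (y = (i + 1, j) \<or> y = (i, j + 1))"
proof -
  obtain k l where y: "y = (k, l)" by (cases y)
  have less: "(p, q) < (r, s) \<longleftrightarrow> p \<le> r \<and> q \<le> s \<and> (p \<noteq> r \<or> q \<noteq> s)" for p q r s :: nat
    by (auto simp: less_le)
  show ?thesis
  proof
    assume c: "covered_by (rect a b) (i, j) y"
    then have in_rect: "(i, j) \<in> rect a b" "(k, l) \<in> rect a b" and lt: "(i, j) < (k, l)"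
      and no: "\<And>z. z \<in> rect a b \<Longrightarrow> (i, j) < z \<Longrightarrow> \<not> z < (k, l)"
      by (auto simp: covered_by_def y)
    have "(k, l) = (i + 1, j)" if "i < k"
      using no[of "(i + 1, j)"] in_rect lt that by (auto simp: less rect_def)
    moreover have "(k, l) = (i, j + 1)" if "\<not> i < k"
      using no[of "(i, j + 1)"] in_rect lt that by (auto simp: less rect_def)
    ultimately show "(i, j) \<in> rect a b \<and> y \<in> rect a b \<and> (y = (i + 1, j) \<or> y = (i, j + 1))"
      using in_rect y by blast
  next
    assume "(i, j) \<in> rect a b \<and> y \<in> rect a b \<and> (y = (i + 1, j) \<or> y = (i, j + 1))"
    then show "covered_by (rect a b) (i, j) y"
      unfolding covered_by_def y by (auto simp: less)
  qed
qed

lemma finite_saturated_chains: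
  assumes "finite P"
  shows "finite (saturated_chains P x)"
proof (rule finite_subset[OF _ finite_subset_distinct[OF assms]])
  have "distinct ys" if "successively (covered_by P) ys" for ys
  proof -
    have "successively (<) ys"
      using that by (rule successively_mono) (auto simp: covered_by_def)
    then have "sorted_wrt (<) ys"
      by (simp add: successively_conv_sorted_wrt)
    then show ?thesis
      by (induction ys) auto
  qed
  then show "saturated_chains P x \<subseteq> {ys. set ys \<subseteq> P \<and> distinct ys}"
    by (auto simp: saturated_chains_def)
qed

lemma saturated_chains_nonempty:
  assumes "finite P" "x \<in> P"
  shows "saturated_chains P x \<noteq> {}"
  using assms(2)
proof (induction "card {z\<in>P. x < z}" arbitrary: x rule: less_induct)
  case less
  show ?case
  proof (cases "\<exists>z\<in>P. x < z")
    case False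
    with less.prems have "[x] \<in> saturated_chains P x"
      by (auto simp: saturated_chains_def)
    then show ?thesis by blast
  next
    case True
    then obtain y where y: "y \<in> P" "x < y" and ymin: "\<And>z. z \<in> P \<Longrightarrow> x < z \<Longrightarrow> \<not> z < y"
      using finite_has_minimal[of "{z\<in>P. x < z}"] assms(1) by (fastforce simp: less_le)
    have "{z\<in>P. y < z} \<subset> {z\<in>P. x < z}"
      using y by auto
    then have "card {z\<in>P. y < z} < card {z\<in>P. x < z}"
      using assms(1) by (intro psubset_card_mono) auto
    from less.hyps[OF this y(1)] obtain ys where "ys \<in> saturated_chains P y"
      by blast
    moreover have "covered_by P x y"
      using less.prems y ymin by (auto simp: covered_by_def)
    ultimately have "x # ys \<in> saturated_chains P x"
      using less.prems by (cases ys) (auto simp: saturated_chains_def)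
    then show ?thesis by blast
  qed
qed

text \<open>
  \<open>BAR_dom P C\<close> is the set of labelings at which finitely many rational functions are defined and
  nonzero, so by the next lemma it is a nonempty, hence dense, Zariski-open set.
\<close>

lemma const_in_BAR_dom:
  fixes C :: "'k::field_char_0"
  assumes "finite P" "C \<noteq> 0"
  shows "(\<lambda>_. 1) \<in> BAR_dom P C"
proof -
  let ?n = "\<lambda>x. card (saturated_chains P x)"
  have n: "?n x > 0" if "x \<in> P" for x
    using finite_saturated_chains saturated_chains_nonempty assms(1) that
    by (metis card_gt_0_iff)
  have D: "Delta_inv P (\<lambda>_. 1) x = (of_nat (?n x) :: 'k)" for x
    by (simp add: Delta_inv_def map_replicate_const)
  have "lower_sum P (Theta C (Delta_inv P (\<lambda>_. 1))) x \<noteq> 0" for x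
  proof (cases "{y. covered_by P y x} = {}")
    case True
    then show ?thesis by (simp add: lower_sum_def)
  next
    case False
    let ?Y = "{y. covered_by P y x}"
    have Y: "?Y \<subseteq> P" by (auto simp: covered_by_def)
    then have "finite ?Y" using assms(1) finite_subset by blast
    then have "0 < (\<Sum>y\<in>?Y. 1 / of_nat (?n y) :: rat)"
      using n Y False by (intro sum_pos) auto
    then have "of_rat (\<Sum>y\<in>?Y. 1 / of_nat (?n y)) \<noteq> (0::'k)"
      by (metis less_irrefl of_rat_eq_0_iff)
    moreover have "lower_sum P (Theta C (Delta_inv P (\<lambda>_. 1))) x =
        C * of_rat (\<Sum>y\<in>?Y. 1 / of_nat (?n y))"
      using False
      by (simp add: lower_sum_def Theta_def D of_rat_sum of_rat_divide sum_distrib_left)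
    ultimately show ?thesis using assms(2) by simp
  qed
  moreover have "Delta_inv P (\<lambda>_. 1) x \<noteq> (0::'k)" if "x \<in> P" for x
    using n[OF that] by (simp add: D)
  ultimately show ?thesis
    by (auto simp: BAR_dom_def Theta_dom_def Nabla_dom_def)
qed

end

theory Submission
  imports Defs
begin

text \<open>
  Applying \<open>\<nabla>\<close> to \<open>C / D\<close>, where \<open>D = \<Delta>\<^sup>-\<^sup>1 g\<close>, gives at an interior point the denominator
  \<open>C / D(i-1,j) + C / D(i,j-1)\<close>, where \<open>C\<close> cancels. The remaining numerator \<open>D(i-1,j) + D(i,j-1)\<close> runs over the two
  elements covering \<open>(i-1,j-1)\<close>, so by the recursion for \<open>\<Delta>\<^sup>-\<^sup>1\<close> it is
  \<open>D(i-1,j-1) / g(i-1,j-1)\<close>.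
\<close>

text \<open>A chain that ends in a maximal element cannot stop at a non-maximal \<open>x\<close>.
  Its second element covers \<open>x\<close>, and deleting \<open>x\<close> changes neither the end
  of the chain nor its saturation.\<close>

lemma saturated_chains_Cons:
  assumes "x \<in> P" "\<exists>z\<in>P. x < z"
  shows "saturated_chains P x = (\<Union>y\<in>{y. covered_by P x y}. (#) x ` saturated_chains P y)"
proof (intro equalityI subsetI)
  fix ys assume ys: "ys \<in> saturated_chains P x"
  then obtain zs where zs: "ys = x # zs"
    by (cases ys) (auto simp: saturated_chains_def)
  with ys assms have "zs \<noteq> []"
    by (auto simp: saturated_chains_def)
  with ys zs have "covered_by P x (hd zs)" "zs \<in> saturated_chains P (hd zs)"
    by (auto simp: saturated_chains_def successively_Cons)
  with zs show "ys \<in> (\<Union>y\<in>{y. covered_by P x y}. (#) x ` saturated_chains P y)"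
    by blast
next
  fix ys assume "ys \<in> (\<Union>y\<in>{y. covered_by P x y}. (#) x ` saturated_chains P y)"
  with assms show "ys \<in> saturated_chains P x"
    by (auto simp: saturated_chains_def successively_Cons)
qed

text \<open>The chains from \<open>x\<close> are sorted by their second element, and the common
  factor \<open>f x\<close> is pulled out of every product.\<close>

lemma Delta_inv_rec:
  assumes "finite P" "x \<in> P" "\<exists>z\<in>P. x < z"
  shows "Delta_inv P f x = f x * (\<Sum>y | covered_by P x y. Delta_inv P f y)"
proof -
  have "finite {y. covered_by P x y}"
    using assms(1) by (rule finite_subset[rotated]) (auto simp: covered_by_def)
  \<comment> \<open>The second entry of a chain tells which class it belongs to.\<close>
  moreover have "((#) x ` saturated_chains P y) \<inter> ((#) x ` saturated_chains P z) = {}"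
    if "y \<noteq> z" for y z
    using that by (auto simp: saturated_chains_def)
  ultimately have "Delta_inv P f x =
      (\<Sum>y | covered_by P x y. \<Sum>ys\<in>(#) x ` saturated_chains P y. prod_list (map f ys))"
    unfolding Delta_inv_def saturated_chains_Cons[OF assms(2,3)]
    by (intro sum.UNION_disjoint) (auto simp: finite_saturated_chains[OF assms(1)])
  also have "\<dots> = f x * (\<Sum>y | covered_by P x y. Delta_inv P f y)"
    by (simp add: sum.reindex Delta_inv_def sum_distrib_left)
  finally show ?thesis .
qed

lemma mem_rect: "(i, j) \<in> rect a b \<longleftrightarrow> 1 \<le> i \<and> i \<le> a \<and> 1 \<le> j \<and> j \<le> b"
  by (auto simp: rect_def)

text \<open>The strict bounds keep both upper covers inside the rectangle; on the edges
  \<open>i = a\<close> or \<open>j = b\<close> at least one is missing.\<close>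

lemma Delta_inv_rect_rec:
  assumes "(i, j) \<in> rect a b" "i < a" "j < b"
  shows "Delta_inv (rect a b) f (i, j) =
    f (i, j) * (Delta_inv (rect a b) f (i + 1, j) + Delta_inv (rect a b) f (i, j + 1))"
proof -
  have "{y. covered_by (rect a b) (i, j) y} = {(i + 1, j), (i, j + 1)}"
    using assms by (auto simp: covered_by_rect mem_rect)
  moreover have "\<exists>z\<in>rect a b. (i, j) < z"
    using assms by (intro bexI[of _ "(i + 1, j)"]) (auto simp: mem_rect less_le)
  ultimately show ?thesis
    using Delta_inv_rec[OF _ assms(1)] by (simp add: rect_def)
qed

lemma lower_sum_rect:
  assumes "(i, j) \<in> rect a b"
  shows "lower_sum (rect a b) f (i, j) =
    (if i = 1 \<and> j = 1 then 1
     else (if i = 1 then 0 else f (i - 1, j)) + (if j = 1 then 0 else f (i, j - 1)))"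
proof -
  have "{y. covered_by (rect a b) y (i, j)} =
      (if i = 1 then {} else {(i - 1, j)}) \<union> (if j = 1 then {} else {(i, j - 1)})"
    using assms by (auto simp: covered_by_rect mem_rect)
  \<comment> \<open>Subtraction on naturals truncates, so this needs \<open>i\<close> to be
    positive. It makes the two lower covers distinct, so that the sum over their set has two
    terms.\<close>
  moreover have "i - 1 \<noteq> i"
    using assms by (auto simp: mem_rect)
  ultimately show ?thesis
    by (simp add: lower_sum_def)
qed

theorem theorem5p1:
  fixes a b :: nat and C :: "'k::field_char_0" and g :: "nat \<times> nat \<Rightarrow> 'k"
  defines "P \<equiv> rect a b"
  assumes "a > 0" and "b > 0" and "C \<noteq> 0" and "g \<in> BAR_dom P C"
  shows "BAR P C g (1, 1) = C / Delta_inv P g (1, 1) \<and>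
    (\<forall>j\<in>{2..b}. BAR P C g (1, j) = Delta_inv P g (1, j - 1) / Delta_inv P g (1, j)) \<and>
    (\<forall>i\<in>{2..a}. BAR P C g (i, 1) = Delta_inv P g (i - 1, 1) / Delta_inv P g (i, 1)) \<and>
    (\<forall>i\<in>{2..a}. \<forall>j\<in>{2..b}. BAR P C g (i, j) =
       (Delta_inv P g (i - 1, j) * Delta_inv P g (i, j - 1) * g (i - 1, j - 1)) /
       (Delta_inv P g (i - 1, j - 1) * Delta_inv P g (i, j)))"
proof -
  define D where "D = Delta_inv P g"
  have nz: "D x \<noteq> 0" if "x \<in> P" for x
    using assms(5) that by (simp add: D_def BAR_dom_def Theta_dom_def)
  have BAR: "BAR P C g x = C / D x / lower_sum P (\<lambda>y. C / D y) x" for x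
    by (simp add: BAR_def Nabla_def Theta_def[abs_def] D_def)
  have mem_P: "(i, j) \<in> P \<longleftrightarrow> 1 \<le> i \<and> i \<le> a \<and> 1 \<le> j \<and> j \<le> b" for i j
    by (simp add: P_def mem_rect)
  note lower_sum = lower_sum_rect[of _ _ a b, folded P_def]
  have one: "BAR P C g (1, 1) = C / D (1, 1)"
    using assms(2,3) by (simp add: BAR lower_sum mem_P)
  \<comment> \<open>On an edge the lower sum is a single quotient with numerator \<open>C\<close>,
    and \<open>C\<close> cancels because it is nonzero.\<close>
  have row: "BAR P C g (1, j) = D (1, j - 1) / D (1, j)" if "j \<in> {2..b}" for j
    using that assms(2,4) by (simp add: BAR lower_sum mem_P)
  have column: "BAR P C g (i, 1) = D (i - 1, 1) / D (i, 1)" if "i \<in> {2..a}" for i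
    using that assms(3,4) by (simp add: BAR lower_sum mem_P)
  have interior: "BAR P C g (i, j) =
      (D (i - 1, j) * D (i, j - 1) * g (i - 1, j - 1)) / (D (i - 1, j - 1) * D (i, j))"
    if i: "i \<in> {2..a}" and j: "j \<in> {2..b}" for i j
  proof -
    have mem: "(i - 1, j) \<in> P" "(i, j - 1) \<in> P" "(i - 1, j - 1) \<in> P" "(i, j) \<in> P"
      using i j by (auto simp: mem_P)
    have rec: "D (i - 1, j - 1) = g (i - 1, j - 1) * (D (i, j - 1) + D (i - 1, j))"
      using Delta_inv_rect_rec[of "i - 1" "j - 1" a b g] mem i j by (force simp: D_def P_def)
    \<comment> \<open>Membership in \<open>BAR_dom\<close> only says that \<open>D\<close> does not
      vanish on \<open>P\<close>; since \<open>D (i - 1, j - 1)\<close> is the product of these two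
      factors, neither vanishes and both may be cancelled.\<close>
    then have factors: "g (i - 1, j - 1) \<noteq> 0" "D (i, j - 1) + D (i - 1, j) \<noteq> 0"
      using nz[OF mem(3)] by auto
    have "lower_sum P (\<lambda>y. C / D y) (i, j) = C / D (i - 1, j) + C / D (i, j - 1)"
      using lower_sum[OF mem(4)] i j by simp
    also have "\<dots> = C * (D (i, j - 1) + D (i - 1, j)) / (D (i - 1, j) * D (i, j - 1))"
      using nz[OF mem(1)] nz[OF mem(2)] by (simp add: field_simps)
    \<comment> \<open>Rewriting with \<open>rec\<close> replaces \<open>D (i - 1, j - 1)\<close> in
      the goal by its factorization; then \<open>g (i - 1, j - 1)\<close> cancels on the right and
      \<open>C\<close> on the left.\<close>
    finally show ?thesis
      using factors assms(4) unfolding BAR rec by simp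
  qed
  show ?thesis
    using one row column interior unfolding D_def by blast
qed

end
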